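(* Let $X$ be a Banach space satisfying one of the following conditions: (i) $X$ has a shrinking finite-dimensional decomposition $(E_n)_{n=1}^\infty$; (ii) $X^*$ has a semi-normalized weak$^*$-null basis $(e_n^* )_{n=1}^\infty$. Let also $Z$ be a Banach space such that $X^*\subseteq Z$ as sets, and such that for some constants $0<C_1,C_2<\infty$ we have $$C_1\|x^*\|_Z\leq\|x^*\|_{X^*}\leq C_2\|x^*\|_Z\quad\text{for each } x^*\in X^*.$$ Assume that $\varphi,\psi,\chi\colon[0,\infty)\to[0,\infty)$ are continuous bijections such that for each $x^*\in X^*$ and all sufficiently large $n\in\mathbb{N}$, we have $$\chi(\|x^*\|_Z)\leq\varphi(\|P_n(x^* )\|_Z)+\psi(\|(I-P_n)(x^* )\|_Z),$$ where $P_n\colon X^*\to X^*$ is the canonical projection onto $\mathrm{span}\bigcup_{j\leq n}E_j^*$ in the case where (i) holds, or onto the linear span of $e_1^*,\ldots,e_n^*$ in the case where (ii) holds. Then, for every $0<\varepsilon<2C_1\psi^{-1}(\chi(\tfrac{1}{C_2}))$, we have $$r_X(\varepsilon)\geq C_1\,\varphi^{-1}\Big(\chi\Big(\frac{1}{C_2}\Big)-\psi\Big(\frac{\varepsilon}{2C_1}\Big)\Big).$$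
   Context: For a weak$^*$-compact set $K\subset X^*$ and $\varepsilon\in(0,2)$, the $\varepsilon$-Szlenk derivation of $K$ is $$s_\varepsilon K=\{x^*\in K\colon \mathrm{diam}(K\cap V)>\varepsilon\text{ for every weak}^*\text{-open neighborhood }V\text{ of }x^*\},$$ where the diameter is taken with respect to the norm of $X^*$. $B_{X^*}$ denotes the closed unit ball of $X^*$, and $$r_X(\varepsilon)=\sup\{r>0\colon r B_{X^*}\subseteq s_\varepsilon B_{X^*}\}.$$ A sequence $(E_n)_{n=1}^\infty$ of (nonzero) finite-dimensional subspaces of $X$ is a finite-dimensional decomposition (FDD) of $X$ if for every $x\in X$ there is a unique sequence $(x_n)$ with $x_n\in E_n$ for each $n$ and $x=\sum_{n=1}^\infty x_n$. Let $Q_n\colon X\to X$ be the partial sum projection $Q_n(\sum_{i=1}^\infty x_i)=\sum_{i=1}^n x_i$ (where $x_i\in E_i$). The space $E_n^*$ is identified with the subspace of $X^*$ consisting of the functionals vanishing on $E_j$ for all $j\neq n$, and it carries the norm inherited from $X^*$. The FDD is shrinking if the norm closure in $X^*$ of the linear span of $\bigcup_n E_n^*$ is all of $X^*$; in this case $(E_n^* )_{n=1}^\infty$ is an FDD of $X^*$. In case (i), $P_n$ is the $n$-th partial sum projection of $(E_n^* )$, i.e. $P_n=Q_n^*$. In case (ii), basis means Schauder basis and $P_n(\sum_{i=1}^\infty a_i e_i^* )=\sum_{i=1}^n a_i e_i^*$. A sequence $(e_n^* )$ is semi-normalized if $0<\inf_n\|e_n^*\|\leq\sup_n\|e_n^*\|<\infty$.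 $I$ is the identity on $X^*$.
   Formalization: "For each x* and all sufficiently large n" is taken with a threshold for n that does not depend on x*; with a threshold depending on x* the claim fails, e.g. X=c_0, Z=ℓ_1, C_1=C_2=1, χ(t)=t, φ(t)=2t, ψ(t)=t/100, ε=1.8. *)

theory Defs
  imports "HOL-Analysis.Analysis"
begin

(* On X* = ('a \<Rightarrow>\<^sub>L real) the strong operator topology is the topology of pointwise
   convergence on X, i.e. the weak* topology. *)
abbreviation weak_star :: "('a::real_normed_vector \<Rightarrow>\<^sub>L real) topology" where
  "weak_star \<equiv> strong_operator_topology"

(* The library's diameter is a real supremum, so it is meaningful only for bounded K;
   weak*-compact sets in the dual of a Banach space are bounded. *)
definition szlenk_deriv ::
  "real \<Rightarrow> ('a::banach \<Rightarrow>\<^sub>L real) set \<Rightarrow> ('a \<Rightarrow>\<^sub>L real) set" where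
  "szlenk_deriv \<epsilon> K =
     {f \<in> K. \<forall>V. openin weak_star V \<and> f \<in> V \<longrightarrow> diameter (K \<inter> V) > \<epsilon>}"

(* For infinite-dimensional X and 0 < \<epsilon> < 2 the set below is nonempty (it contains all
   0 < r < 1 - \<epsilon>/2) and bounded above by 1, so the supremum is a genuine one. *)
definition szlenk_radius :: "'a::banach itself \<Rightarrow> real \<Rightarrow> real" where
  "szlenk_radius X \<epsilon> =
     Sup {r. r > 0 \<and> (\<lambda>f. r *\<^sub>R f) ` cball (0 :: 'a \<Rightarrow>\<^sub>L real) 1
                       \<subseteq> szlenk_deriv \<epsilon> (cball 0 1)}"

(* All sequences are indexed from 0, so the n-th partial sum is over {..<n}. *)

definition is_FDD :: "(nat \<Rightarrow> 'a::banach set) \<Rightarrow> bool" where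
  "is_FDD E \<longleftrightarrow>
     (\<forall>n. (\<exists>B. finite B \<and> E n = span B) \<and> E n \<noteq> {0}) \<and>
     (\<forall>x. \<exists>!xs. (\<forall>i. xs i \<in> E i) \<and> xs sums x)"

definition FDD_component :: "(nat \<Rightarrow> 'a::banach set) \<Rightarrow> 'a \<Rightarrow> nat \<Rightarrow> 'a" where
  "FDD_component E x = (THE xs. (\<forall>i. xs i \<in> E i) \<and> xs sums x)"

(* Partial sum projections of an FDD of a Banach space are bounded linear maps, so that
   Blinfun does not lose information here. *)
definition FDD_proj :: "(nat \<Rightarrow> 'a::banach set) \<Rightarrow> nat \<Rightarrow> 'a \<Rightarrow>\<^sub>L 'a" where
  "FDD_proj E n = Blinfun (\<lambda>x. \<Sum>i<n. FDD_component E x i)"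

definition FDD_dual :: "(nat \<Rightarrow> 'a::banach set) \<Rightarrow> nat \<Rightarrow> ('a \<Rightarrow>\<^sub>L real) set" where
  "FDD_dual E n = {f. \<forall>j. j \<noteq> n \<longrightarrow> (\<forall>x\<in>E j. blinfun_apply f x = 0)}"

definition shrinking_FDD :: "(nat \<Rightarrow> 'a::banach set) \<Rightarrow> bool" where
  "shrinking_FDD E \<longleftrightarrow> is_FDD E \<and> closure (span (\<Union>n. FDD_dual E n)) = UNIV"

(* The adjoint of the n-th partial sum projection. *)
definition FDD_dual_proj ::
  "(nat \<Rightarrow> 'a::banach set) \<Rightarrow> nat \<Rightarrow> ('a \<Rightarrow>\<^sub>L real) \<Rightarrow> ('a \<Rightarrow>\<^sub>L real)" where
  "FDD_dual_proj E n f = f o\<^sub>L FDD_proj E n"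

definition schauder_basis :: "(nat \<Rightarrow> 'b::banach) \<Rightarrow> bool" where
  "schauder_basis e \<longleftrightarrow> (\<forall>x. \<exists>!a :: nat \<Rightarrow> real. (\<lambda>i. a i *\<^sub>R e i) sums x)"

definition basis_coeff :: "(nat \<Rightarrow> 'b::banach) \<Rightarrow> 'b \<Rightarrow> nat \<Rightarrow> real" where
  "basis_coeff e x = (THE a. (\<lambda>i. a i *\<^sub>R e i) sums x)"

definition basis_proj :: "(nat \<Rightarrow> 'b::banach) \<Rightarrow> nat \<Rightarrow> 'b \<Rightarrow> 'b" where
  "basis_proj e n x = (\<Sum>i<n. basis_coeff e x i *\<^sub>R e i)"

definition semi_normalized :: "(nat \<Rightarrow> 'b::real_normed_vector) \<Rightarrow> bool" where
  "semi_normalized e \<longleftrightarrow>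
     0 < (INF n. norm (e n)) \<and> bdd_above (range (\<lambda>n. norm (e n)))"

definition weak_star_null :: "(nat \<Rightarrow> ('a::real_normed_vector \<Rightarrow>\<^sub>L real)) \<Rightarrow> bool" where
  "weak_star_null e \<longleftrightarrow> limitin weak_star e 0 sequentially"

definition cont_bij_nonneg :: "(real \<Rightarrow> real) \<Rightarrow> bool" where
  "cont_bij_nonneg \<phi> \<longleftrightarrow> bij_betw \<phi> {0..} {0..} \<and> continuous_on {0..} \<phi>"

definition inv_nonneg :: "(real \<Rightarrow> real) \<Rightarrow> real \<Rightarrow> real" where
  "inv_nonneg \<phi> = inv_into {0..} \<phi>"

end

theory Submission
  imports Defs
begin

text \<open>
  In both cases \<open>X\<^sup>*\<close> contains a normalised weak* null sequence \<open>g\<^sub>m\<close> with \<open>P\<^sub>n g\<^sub>m = 0\<close> for \<open>m \<ge> n\<close>,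
  and functionals \<open>f'\<close> with \<open>P\<^sub>n f' = f'\<close> for all large \<open>n\<close> are norm dense. If \<open>\<parallel>f\<parallel>\<close> is below the
  claimed radius, \<open>f'\<close> is close to \<open>f\<close> and \<open>t\<close> slightly exceeds \<open>\<epsilon>/2\<close>, the hypothesis on
  \<open>\<phi>\<close>, \<open>\<psi>\<close>, \<open>\<chi>\<close> puts \<open>f' \<plusminus> t g\<^sub>m\<close> into the unit ball. These points have distance \<open>2t > \<epsilon>\<close> and
  converge weak* to \<open>f'\<close>, so every weak* neighbourhood of \<open>f\<close> meets the ball in a set of diameter
  greater than \<open>\<epsilon>\<close>. Case (i) additionally needs the continuity of the partial sum projections of an
  FDD, which follows from Zabreiko's lemma.
\<close>

subsection \<open>Zabreiko's lemma and finite-dimensional subspaces\<close>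

text \<open>Baire's theorem gives some \<open>k\<close> for which the closure of
  \<open>{x. p x \<le> k}\<close> contains a ball. Countable subadditivity then removes the closure
  as in the open mapping theorem: \<open>x\<close> is written as a series of approximants whose
  \<open>p\<close>-values are dominated by a geometric series.\<close>

lemma zabreiko:
  fixes p :: "'a::banach \<Rightarrow> real"
  assumes nonneg: "\<And>x. 0 \<le> p x"
    and scale: "\<And>a x. p (a *\<^sub>R x) = \<bar>a\<bar> * p x"
    and sub: "\<And>u. summable u \<Longrightarrow> summable (\<lambda>i. p (u i)) \<Longrightarrow> p (suminf u) \<le> (\<Sum>i. p (u i))"
  shows "\<exists>C. \<forall>x. p x \<le> C * norm x"
proof -
  have p0: "p 0 = 0" using scale[of 0 0] by simp
  \<comment> \<open>Finite subadditivity is the countable one for the series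
    \<open>x, y, 0, 0, ...\<close>; \<open>p 0 = 0\<close> removes the tail.\<close>
  have p_add: "p (x + y) \<le> p x + p y" for x y
  proof -
    define u where "u i = (if i = 0 then x else if i = Suc 0 then y else 0)" for i :: nat
    have u: "u sums (\<Sum>i\<in>{0, Suc 0}. u i)"
      by (rule sums_finite) (auto simp: u_def)
    have pu: "(\<lambda>i. p (u i)) sums (\<Sum>i\<in>{0, Suc 0}. p (u i))"
      by (rule sums_finite) (auto simp: u_def p0)
    show ?thesis
      using sub[OF sums_summable[OF u] sums_summable[OF pu]] sums_unique[OF u] sums_unique[OF pu]
      by (simp add: u_def[of 0] u_def[of "Suc 0"])
  qed
  define A where "A k = {x. p x \<le> real k}" for k :: nat
  have cover: "(\<Union>k. closure (A k)) = UNIV"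
  proof -
    have "x \<in> closure (A (nat \<lceil>p x\<rceil>))" for x
      by (rule subsetD[OF closure_subset]) (simp add: A_def nonneg)
    then show ?thesis by blast
  qed
  have "\<exists>k. interior (closure (A k)) \<noteq> {}"
  proof (rule ccontr)
    assume "\<nexists>k. interior (closure (A k)) \<noteq> {}"
    then have "euclidean interior_of \<Union>(range (\<lambda>k. closure (A k))) = {}"
      by (intro Baire_category_alt) (auto simp: completely_metrizable_space_euclidean)
    with cover show False by simp
  qed
  then obtain k a where "a \<in> interior (closure (A k))" by blast
  then obtain e where e: "e > 0" "ball a e \<subseteq> closure (A k)"
    by (auto simp: mem_interior)
  \<comment> \<open>The ball about \<open>a\<close> is moved to the origin: half the difference of
    approximants of \<open>a + x\<close> and \<open>a - x\<close> approximates \<open>x\<close>, and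
    its \<open>p\<close>-value is again at most \<open>k\<close>.\<close>
  have near0: "\<exists>y. p y \<le> real k \<and> norm (x - y) < \<eta>" if "norm x < e" "\<eta> > 0" for x \<eta>
  proof -
    have "a + x \<in> closure (A k)" "a - x \<in> closure (A k)"
      using e(2) that(1) by (auto simp: subset_iff dist_norm)
    then obtain v w where v: "p v \<le> k" "norm (v - (a + x)) < \<eta>"
      and w: "p w \<le> k" "norm (w - (a - x)) < \<eta>"
      using \<open>\<eta> > 0\<close> by (force simp: closure_approachable A_def dist_norm)
    define y where "y = (1/2) *\<^sub>R (v + (-1) *\<^sub>R w)"
    have "p y \<le> real k"
      using p_add[of v "(-1) *\<^sub>R w"] v(1) w(1) unfolding y_def scale by simp
    moreover have "x - y = (1/2) *\<^sub>R ((w - (a - x)) - (v - (a + x)))"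
      by (simp add: y_def algebra_simps flip: scaleR_add_left)
    then have "norm (x - y) < \<eta>"
      using norm_triangle_ineq4[of "w - (a - x)" "v - (a + x)"] v(2) w(2) by simp
    ultimately show ?thesis by blast
  qed
  \<comment> \<open>\<open>x\<close> is rescaled to norm \<open>e / 2\<close>, inside the ball, so
    undoing the scaling multiplies the bound \<open>k\<close> by
    \<open>2 * norm x / e\<close>.\<close>
  define M where "M = 2 * real k / e"
  have near: "\<exists>y. p y \<le> M * norm x \<and> norm (x - y) \<le> \<eta>" if "\<eta> > 0" for x \<eta>
  proof (cases "x = 0")
    case True
    then show ?thesis using p0 that by (intro exI[of _ 0]) simp
  next
    case False
    define c where "c = e / (2 * norm x)"
    have c: "c > 0" using e(1) False by (simp add: c_def)
    have "norm (c *\<^sub>R x) < e" using e(1) False by (simp add: c_def)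
    from near0[OF this, of "c * \<eta>"] c that
    obtain y where y: "p y \<le> real k" "norm (c *\<^sub>R x - y) < c * \<eta>" by auto
    have "c *\<^sub>R x - y = c *\<^sub>R (x - y /\<^sub>R c)"
      using c by (simp add: algebra_simps)
    with y(2) c have "norm (x - y /\<^sub>R c) \<le> \<eta>" by simp
    moreover have "p (y /\<^sub>R c) \<le> M * norm x"
      using y(1) c e(1) False unfolding scale M_def c_def by (simp add: field_simps)
    ultimately show ?thesis by blast
  qed
  define sel where "sel x \<eta> = (SOME y. p y \<le> M * norm x \<and> norm (x - y) \<le> \<eta>)" for x \<eta>
  have sel: "p (sel x \<eta>) \<le> M * norm x" "norm (x - sel x \<eta>) \<le> \<eta>" if "\<eta> > 0" for x \<eta>
    using someI_ex[OF near[OF that]] unfolding sel_def by blast+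
  have M0: "M \<ge> 0" using e(1) by (simp add: M_def)
  have "p x \<le> (2 * M) * norm x" for x
  proof (cases "x = 0")
    case True
    then show ?thesis by (simp add: p0)
  next
    case False
    \<comment> \<open>\<open>r i\<close> is what is left of \<open>x\<close> after \<open>i\<close>
      approximations. Halving the error each time makes the removed pieces satisfy
      \<open>p (u i) \<le> M * norm x / 2 ^ i\<close>, with total at most
      \<open>2 * M * norm x\<close>.\<close>
    define r where "r = rec_nat x (\<lambda>i z. z - sel z (norm x * (1/2) ^ Suc i))"
    have r_Suc: "r (Suc i) = r i - sel (r i) (norm x * (1/2) ^ Suc i)" for i
      by (simp add: r_def)
    have r0: "r 0 = x" by (simp add: r_def)
    have r_le: "norm (r i) \<le> norm x * (1/2) ^ i" for i
    proof (cases i)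
      case 0
      then show ?thesis by (simp add: r0)
    next
      case (Suc l)
      show ?thesis
        unfolding Suc r_Suc by (rule sel(2)) (use False in simp)
    qed
    define u where "u i = r i - r (Suc i)" for i
    have p_u: "p (u i) \<le> M * norm x * (1/2) ^ i" for i
    proof -
      have "p (u i) \<le> M * norm (r i)"
        unfolding u_def r_Suc using sel(1)[of "norm x * (1/2) ^ Suc i" "r i"] False by simp
      also have "\<dots> \<le> M * (norm x * (1/2) ^ i)"
        by (intro mult_left_mono r_le M0)
      finally show ?thesis by (simp add: mult.assoc)
    qed
    have geo: "(\<lambda>i. M * norm x * (1/2) ^ i) sums (M * norm x * 2)"
      using sums_mult[OF geometric_sums[of "1/2::real"], of "M * norm x"] by simp
    have "(\<lambda>i. norm x * (1/2) ^ i) \<longlonglongrightarrow> norm x * 0"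
      by (intro tendsto_mult tendsto_const LIMSEQ_power_zero) simp
    then have "r \<longlonglongrightarrow> 0"
      by (intro Lim_null_comparison[of r "\<lambda>i. norm x * (1/2) ^ i"]) (auto simp: r_le)
    then have u: "u sums x"
      using telescope_sums'[of r 0] by (simp add: u_def[abs_def] r0)
    have pu: "summable (\<lambda>i. p (u i))"
      by (rule summable_comparison_test'[OF sums_summable[OF geo], of 0]) (simp add: nonneg p_u)
    have "p x \<le> (\<Sum>i. p (u i))"
      using sub[OF sums_summable[OF u] pu] sums_unique[OF u] by simp
    also have "\<dots> \<le> M * norm x * 2"
      using suminf_le[OF p_u pu sums_summable[OF geo]] sums_unique[OF geo] by simp
    finally show ?thesis by simp
  qed
  then show ?thesis by blast
qed

text \<open>\<open>d\<close> is the distance from \<open>b\<close> to \<open>S\<close>, positive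
  because \<open>S\<close> is closed; dividing by a nonzero \<open>\<alpha>\<close> turns the vector
  into \<open>b\<close> minus a point of \<open>S\<close>. So the coefficient of \<open>b\<close>
  depends continuously on the vector.\<close>

lemma closed_subspace_coeff_bound:
  fixes S :: "'a::real_normed_vector set"
  assumes "closed S" "subspace S" "b \<notin> S"
  shows "\<exists>d>0. \<forall>\<alpha>. \<forall>y\<in>S. d * \<bar>\<alpha>\<bar> \<le> norm (\<alpha> *\<^sub>R b + y)"
proof (intro exI conjI allI ballI)
  show "infdist b S > 0"
    using assms subspace_0 by (intro infdist_pos_not_in_closed) auto
  fix \<alpha> :: real and y assume y: "y \<in> S"
  show "infdist b S * \<bar>\<alpha>\<bar> \<le> norm (\<alpha> *\<^sub>R b + y)"
  proof (cases "\<alpha> = 0")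
    case False
    have "(- 1 / \<alpha>) *\<^sub>R y \<in> S" using assms(2) y by (rule subspace_scale)
    then have "infdist b S \<le> norm (b - (- 1 / \<alpha>) *\<^sub>R y)"
      using infdist_le by (metis dist_norm)
    then have "\<bar>\<alpha>\<bar> * infdist b S \<le> norm (\<alpha> *\<^sub>R (b - (- 1 / \<alpha>) *\<^sub>R y))"
      by (simp add: mult_left_mono)
    also have "\<alpha> *\<^sub>R (b - (- 1 / \<alpha>) *\<^sub>R y) = \<alpha> *\<^sub>R b + y"
      using False by (simp add: algebra_simps)
    finally show ?thesis by (simp add: mult.commute)
  qed simp
qed

text \<open>Induction on \<open>B\<close>: by the coefficient bound the
  \<open>b\<close>-coefficients of a convergent sequence are Cauchy, so the remainders converge too,
  inside the closed \<open>span B\<close>.\<close>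

lemma closed_span_finite:
  fixes B :: "'a::banach set"
  assumes "finite B"
  shows "closed (span B)"
  using assms
proof (induction B)
  case (insert b B)
  show ?case
  proof (cases "b \<in> span B")
    case True
    then show ?thesis using insert.IH by (simp add: span_redundant)
  next
    case False
    obtain d where d: "d > 0" "\<And>\<alpha> y. y \<in> span B \<Longrightarrow> d * \<bar>\<alpha>\<bar> \<le> norm (\<alpha> *\<^sub>R b + y)"
      using closed_subspace_coeff_bound[OF insert.IH subspace_span False] by blast
    show ?thesis
      unfolding closed_sequential_limits
    proof (intro allI impI, elim conjE)
      fix x l assume x: "\<forall>n. x n \<in> span (insert b B)" and l: "x \<longlonglongrightarrow> l"
      obtain \<alpha> where \<alpha>: "\<And>n. x n - \<alpha> n *\<^sub>R b \<in> span B"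
        using x unfolding span_breakdown_eq by metis
      have le: "d * dist (\<alpha> m) (\<alpha> n) \<le> dist (x m) (x n)" for m n
      proof -
        have "d * \<bar>\<alpha> m - \<alpha> n\<bar>
            \<le> norm ((\<alpha> m - \<alpha> n) *\<^sub>R b + ((x m - \<alpha> m *\<^sub>R b) - (x n - \<alpha> n *\<^sub>R b)))"
          by (intro d(2) span_diff \<alpha>)
        also have "(\<alpha> m - \<alpha> n) *\<^sub>R b + ((x m - \<alpha> m *\<^sub>R b) - (x n - \<alpha> n *\<^sub>R b)) = x m - x n"
          by (simp add: algebra_simps)
        finally show ?thesis by (simp add: dist_norm)
      qed
      have "Cauchy \<alpha>"
      proof (rule metric_CauchyI)
        fix e :: real assume "e > 0"
        then obtain N where N: "\<And>m n. m \<ge> N \<Longrightarrow> n \<ge> N \<Longrightarrow> dist (x m) (x n) < d * e"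
          using metric_CauchyD[OF LIMSEQ_imp_Cauchy[OF l], of "d * e"] d(1) by auto
        have "dist (\<alpha> m) (\<alpha> n) < e" if "m \<ge> N" "n \<ge> N" for m n
          using le[of m n] N[OF that] d(1)
          by (smt (verit) mult_less_cancel_left_pos)
        then show "\<exists>N. \<forall>m\<ge>N. \<forall>n\<ge>N. dist (\<alpha> m) (\<alpha> n) < e" by blast
      qed
      then obtain \<beta> where "\<alpha> \<longlonglongrightarrow> \<beta>" using Cauchy_convergent convergentD by blast
      then have "(\<lambda>n. x n - \<alpha> n *\<^sub>R b) \<longlonglongrightarrow> l - \<beta> *\<^sub>R b"
        by (intro tendsto_intros l)
      then have "l - \<beta> *\<^sub>R b \<in> span B"
        by (rule closed_sequentially[OF insert.IH \<alpha>])
      then show "l \<in> span (insert b B)"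
        unfolding span_breakdown_eq by blast
    qed
  qed
qed simp

subsection \<open>Continuous bijections of the half-line\<close>

text \<open>A continuous injection on an interval is strictly monotone. Were it decreasing,
  \<open>\<phi> 0\<close> would be its largest value, while surjectivity makes it attain
  \<open>\<phi> 0 + 1\<close>.\<close>

lemma cont_bij_nonneg_strict_mono:
  assumes "cont_bij_nonneg \<phi>"
  shows "strict_mono_on {0..} \<phi>"
proof -
  have bij: "bij_betw \<phi> {0..} {0..}" and cont: "continuous_on {0..} \<phi>"
    using assms by (auto simp: cont_bij_nonneg_def)
  have im: "\<phi> ` {0..} = {0..}" and inj: "inj_on \<phi> {0..}"
    using bij by (auto simp: bij_betw_def)
  have "\<not> strict_antimono_on {0..} \<phi>"
  proof
    assume anti: "strict_antimono_on {0..} \<phi>"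
    have "\<phi> 0 \<ge> 0" using im by auto
    then have "\<phi> 0 + 1 \<in> \<phi> ` {0..}" using im by simp
    then obtain x where x: "x \<ge> 0" "\<phi> x = \<phi> 0 + 1" by auto
    then show False
      using monotone_onD[OF anti, of 0 x] by (cases "x = 0") auto
  qed
  then show ?thesis
    using injective_eq_monotone_map[OF _ cont] inj by (auto simp: is_interval_ci)
qed

lemma cont_bij_nonneg_less_iff:
  assumes "cont_bij_nonneg \<phi>" "0 \<le> x" "0 \<le> y"
  shows "\<phi> x < \<phi> y \<longleftrightarrow> x < y"
  using strict_mono_on_less[OF cont_bij_nonneg_strict_mono[OF assms(1)]] assms(2,3) by simp

lemma cont_bij_nonneg_inv:
  assumes "cont_bij_nonneg \<phi>" "0 \<le> y"
  shows "0 \<le> inv_nonneg \<phi> y" "\<phi> (inv_nonneg \<phi> y) = y"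
proof -
  have "y \<in> \<phi> ` {0..}"
    using assms by (auto simp: cont_bij_nonneg_def bij_betw_def)
  then show "0 \<le> inv_nonneg \<phi> y" "\<phi> (inv_nonneg \<phi> y) = y"
    using inv_into_into[of y \<phi> "{0..}"] f_inv_into_f[of y \<phi> "{0..}"]
    by (auto simp: inv_nonneg_def)
qed

lemma cont_bij_nonneg_nonneg:
  assumes "cont_bij_nonneg \<phi>" "0 \<le> x"
  shows "0 \<le> \<phi> x"
  using assms by (auto simp: cont_bij_nonneg_def bij_betw_def)

lemma cont_bij_nonneg_zero:
  assumes "cont_bij_nonneg \<phi>"
  shows "\<phi> 0 = 0"
  using cont_bij_nonneg_inv[OF assms, of 0] cont_bij_nonneg_less_iff[OF assms, of 0 "inv_nonneg \<phi> 0"]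
    cont_bij_nonneg_nonneg[OF assms, of 0] by force

text \<open>Continuity in the form that lets an argument be enlarged by a small \<open>x > 0\<close>
  without spoiling a strict inequality; positive \<open>x\<close> keeps \<open>a + x\<close> in the
  half-line.\<close>

lemma cont_bij_nonneg_tendsto:
  assumes "cont_bij_nonneg \<phi>" "0 \<le> a"
  shows "((\<lambda>x. \<phi> (a + x)) \<longlongrightarrow> \<phi> a) (at_right 0)"
proof -
  have "continuous_on {0..} \<phi>" using assms(1) by (simp add: cont_bij_nonneg_def)
  then have "(\<phi> \<longlongrightarrow> \<phi> a) (at a within {0..})"
    using assms(2) by (simp add: continuous_on_def)
  moreover have "filterlim (\<lambda>x. a + x) (at a within {0..}) (at_right 0)"
    unfolding filterlim_at
  proof
    show "((\<lambda>x. a + x) \<longlongrightarrow> a) (at_right 0)"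
      by (rule tendsto_eq_intros refl tendsto_ident_at | simp)+
    show "\<forall>\<^sub>F x in at_right 0. a + x \<in> {0..} \<and> a + x \<noteq> a"
      using eventually_at_right_less[of "0::real"] by eventually_elim (use assms(2) in auto)
  qed
  ultimately show ?thesis by (rule filterlim_compose)
qed

subsection \<open>Finite-dimensional decompositions\<close>

locale fdd =
  fixes E :: "nat \<Rightarrow> 'a::banach set"
  assumes is_FDD: "is_FDD E"
begin

text \<open>The plain function behind \<open>FDD_proj\<close>: \<open>Blinfun\<close> reveals its
  values only once boundedness is known, and that has to be proved first.\<close>

definition psum :: "nat \<Rightarrow> 'a \<Rightarrow> 'a" where
  "psum n x = (\<Sum>i<n. FDD_component E x i)"

lemma finite_dim: obtains B where "finite B" "E n = span B"
  using is_FDD unfolding is_FDD_def by metis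

lemma subspace: "subspace (E n)"
  by (rule finite_dim[of n]) (simp add: subspace_span)

lemma closed: "closed (E n)"
  by (rule finite_dim[of n]) (simp add: closed_span_finite)

lemma component: "FDD_component E x i \<in> E i" "FDD_component E x sums x"
proof -
  have "\<exists>!xs. (\<forall>i. xs i \<in> E i) \<and> xs sums x"
    using is_FDD by (auto simp: is_FDD_def)
  from theI'[OF this] show "FDD_component E x i \<in> E i" "FDD_component E x sums x"
    unfolding FDD_component_def by blast+
qed

lemma component_unique: "(\<And>i. xs i \<in> E i) \<Longrightarrow> xs sums x \<Longrightarrow> FDD_component E x = xs"
  using the1_equality[of "\<lambda>xs. (\<forall>i. xs i \<in> E i) \<and> xs sums x" xs] is_FDD
  by (simp add: is_FDD_def FDD_component_def)

lemma component_add: "FDD_component E (x + y) i = FDD_component E x i + FDD_component E y i"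
proof -
  have "FDD_component E (x + y) = (\<lambda>i. FDD_component E x i + FDD_component E y i)"
    by (rule component_unique) (auto intro: subspace_add[OF subspace] sums_add component)
  then show ?thesis by simp
qed

lemma component_scale: "FDD_component E (a *\<^sub>R x) i = a *\<^sub>R FDD_component E x i"
proof -
  have "FDD_component E (a *\<^sub>R x) = (\<lambda>i. a *\<^sub>R FDD_component E x i)"
    by (rule component_unique) (auto intro: subspace_scale[OF subspace] sums_scaleR_right component)
  then show ?thesis by simp
qed

lemma component_of_mem:
  assumes "x \<in> E m"
  shows "FDD_component E x = (\<lambda>i. if i = m then x else 0)"
proof (rule component_unique)
  show "(if i = m then x else 0) \<in> E i" for i
    using assms subspace_0[OF subspace] by simp
  show "(\<lambda>i. if i = m then x else 0) sums x"
    using sums_single[of m "\<lambda>_. x"] by simp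
qed

lemma psum_tendsto: "(\<lambda>n. psum n x) \<longlonglongrightarrow> x"
  using component(2)[of x] by (simp add: sums_def psum_def)

lemma bdd_above_psum: "bdd_above (range (\<lambda>n. norm (psum n x)))"
proof -
  have "Bseq (\<lambda>n. psum n x)"
    using psum_tendsto by (intro convergent_imp_Bseq convergentI)
  then show ?thesis by (auto simp: Bseq_def intro: bdd_aboveI2)
qed

lemma psum_le_SUP: "norm (psum n x) \<le> (SUP n. norm (psum n x))"
  by (rule cSUP_upper[OF _ bdd_above_psum]) simp

text \<open>The supremum norm of the partial sums is countably subadditive: summing the components of a
  series block by block yields the components of its sum, since the blocks are closed.\<close>

lemma psum_bound: "\<exists>C. \<forall>n x. norm (psum n x) \<le> C * norm x"
proof -
  define p where "p x = (SUP n. norm (psum n x))" for x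
  have psum_le: "norm (psum n x) \<le> p x" for n x
    unfolding p_def by (rule psum_le_SUP)
  have norm_le: "norm x \<le> p x" for x
    by (rule LIMSEQ_le_const2[OF tendsto_norm[OF psum_tendsto]]) (simp add: psum_le)
  have "\<exists>C. \<forall>x. p x \<le> C * norm x"
  proof (rule zabreiko)
    show "0 \<le> p x" for x
      using order_trans[OF norm_ge_zero psum_le] .
    show "p (a *\<^sub>R x) = \<bar>a\<bar> * p x" for a x
    proof -
      have le: "p (a *\<^sub>R x) \<le> \<bar>a\<bar> * p x" for a x
        unfolding p_def[of "a *\<^sub>R x"]
        by (rule cSUP_least)
          (auto simp: psum_def component_scale simp flip: scaleR_sum_right
            intro!: mult_left_mono psum_le[unfolded psum_def])
      show ?thesis
      proof (cases "a = 0")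
        case True
        then show ?thesis
          using component_scale[of 0] by (simp add: p_def psum_def)
      next
        case False
        \<comment> \<open>The inequality just proved, for the scalar \<open>1 / a\<close> and the
          vector \<open>a *\<^sub>R x\<close>, yields the converse.\<close>
        have "\<bar>a\<bar> * p ((1 / a) *\<^sub>R (a *\<^sub>R x)) \<le> \<bar>a\<bar> * (\<bar>1 / a\<bar> * p (a *\<^sub>R x))"
          by (intro mult_left_mono le) simp
        with False le[of a x] show ?thesis by simp
      qed
    qed
    fix u assume u: "summable u" and pu: "summable (\<lambda>i. p (u i))"
    have psum_u: "summable (\<lambda>i. psum N (u i))" for N
      by (rule summable_comparison_test'[OF pu, of 0]) (simp add: psum_le)
    \<comment> \<open>A component is the difference of consecutive partial sums, so its series
      inherits summability.\<close>
    have comp_u: "summable (\<lambda>i. FDD_component E (u i) n)" for n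
      using summable_diff[OF psum_u psum_u, of "Suc n" n] by (simp add: psum_def)
    define y where "y n = (\<Sum>i. FDD_component E (u i) n)" for n
    have psum_y: "(\<Sum>n<N. y n) = (\<Sum>i. psum N (u i))" for N
      unfolding y_def psum_def by (simp add: suminf_sum comp_u)
    have y_in: "y n \<in> E n" for n
    proof (rule closed_sequentially[OF closed])
      show "(\<Sum>i<k. FDD_component E (u i) n) \<in> E n" for k
        by (intro subspace_sum subspace component)
      show "(\<lambda>k. \<Sum>i<k. FDD_component E (u i) n) \<longlonglongrightarrow> y n"
        unfolding y_def by (rule summable_LIMSEQ[OF comp_u])
    qed
    \<comment> \<open>Two limits are exchanged: in \<open>k\<close>, over the terms of the series,
      and in \<open>N\<close>, over the partial sums. Since \<open>p\<close> bounds all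
      \<open>psum N\<close> at once, \<open>p (u i)\<close> is a majorant independent of
      \<open>N\<close>, and the convergence in \<open>k\<close> is uniform.\<close>
    have y_sums: "y sums suminf u"
      unfolding sums_def psum_y
    proof (rule swap_uniform_limit')
      show "uniform_limit UNIV (\<lambda>k N. \<Sum>i<k. psum N (u i)) (\<lambda>N. \<Sum>i. psum N (u i)) sequentially"
        by (rule Weierstrass_m_test[OF _ pu]) (simp add: psum_le)
      show "\<forall>\<^sub>F k in sequentially. (\<lambda>N. \<Sum>i<k. psum N (u i)) \<longlonglongrightarrow> (\<Sum>i<k. u i)"
        by (intro always_eventually allI tendsto_sum psum_tendsto)
      show "(\<lambda>k. \<Sum>i<k. u i) \<longlonglongrightarrow> suminf u"
        by (rule summable_LIMSEQ[OF u])
    qed auto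
    have comp: "FDD_component E (suminf u) = y"
      by (rule component_unique[OF y_in y_sums])
    show "p (suminf u) \<le> (\<Sum>i. p (u i))"
      unfolding p_def[of "suminf u"]
    proof (rule cSUP_least)
      fix N
      have "norm (psum N (suminf u)) = norm (\<Sum>i. psum N (u i))"
        by (simp add: psum_def[of N "suminf u"] comp psum_y)
      also have "\<dots> \<le> (\<Sum>i. p (u i))"
        by (rule norm_suminf_le[OF psum_le pu])
      finally show "norm (psum N (suminf u)) \<le> (\<Sum>i. p (u i))" .
    qed simp
  qed
  then obtain C where "\<And>x. p x \<le> C * norm x" by blast
  then have "norm (psum n x) \<le> C * norm x" for n x
    by (rule order_trans[OF psum_le])
  then show ?thesis by blast
qed

section \<open>Bounded projections, functionals in the dual components, adjoint projections\<close>

lemma psum_add: "psum n (x + y) = psum n x + psum n y"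
  by (simp add: psum_def component_add sum.distrib)

lemma psum_scale: "psum n (a *\<^sub>R x) = a *\<^sub>R psum n x"
  by (simp add: psum_def component_scale scaleR_sum_right)

lemma FDD_proj_apply: "blinfun_apply (FDD_proj E n) x = psum n x"
proof -
  obtain C where C: "\<And>n x. norm (psum n x) \<le> C * norm x" using psum_bound by blast
  have "bounded_linear (psum n)"
    by (rule bounded_linear_intro[where K = C, OF psum_add psum_scale]) (simp add: C mult.commute)
  then show ?thesis
    by (simp add: FDD_proj_def bounded_linear_Blinfun_apply psum_def[abs_def])
qed

lemma component_bound: "\<exists>C\<ge>0. \<forall>x. norm (FDD_component E x m) \<le> C * norm x"
proof -
  obtain C where C: "\<And>n x. norm (psum n x) \<le> C * norm x" using psum_bound by blast
  have "norm (FDD_component E x m) \<le> (2 * \<bar>C\<bar>) * norm x" for x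
  proof -
    have "FDD_component E x m = psum (Suc m) x - psum m x" by (simp add: psum_def)
    then have "norm (FDD_component E x m) \<le> norm (psum (Suc m) x) + norm (psum m x)"
      by (simp add: norm_triangle_ineq4)
    also have "\<dots> \<le> C * norm x + C * norm x" by (intro add_mono C)
    also have "\<dots> \<le> (2 * \<bar>C\<bar>) * norm x"
      by (simp add: mult_right_mono flip: distrib_right)
    finally show ?thesis .
  qed
  then show ?thesis by (intro exI[of _ "2 * \<bar>C\<bar>"]) auto
qed

text \<open>The coefficient functional of one basis vector \<open>b\<close> of \<open>E m\<close>,
  composed with the \<open>m\<close>-th component map, is 1 at \<open>b\<close> and can be
  normalised. Its continuity combines the distance of \<open>b\<close> from the span of the other
  basis vectors with the bound on components.\<close>

lemma FDD_dual_norm_one: "\<exists>g \<in> FDD_dual E m. norm g = 1"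
proof -
  obtain B0 where B0: "finite B0" "E m = span B0" by (rule finite_dim)
  obtain B where B: "B \<subseteq> B0" "independent B" "span B = E m"
    using maximal_independent_subset[of B0] B0(2)
    by (metis span_eq subset_trans span_superset)
  have "E m \<noteq> {0}" using is_FDD by (auto simp: is_FDD_def)
  with B(3) obtain b where b: "b \<in> B"
    by (metis all_not_in_conv span_empty)
  define S where "S = span (B - {b})"
  have b_S: "b \<notin> S"
    using B(2) b unfolding S_def dependent_def by blast
  have "closed S"
    unfolding S_def by (rule closed_span_finite) (use B(1) B0(1) finite_subset in blast)
  then obtain d where d: "d > 0" "\<And>\<alpha> y. y \<in> S \<Longrightarrow> d * \<bar>\<alpha>\<bar> \<le> norm (\<alpha> *\<^sub>R b + y)"
    using closed_subspace_coeff_bound[OF _ _ b_S] by (auto simp: S_def)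
  obtain h :: "'a \<Rightarrow> real" where h: "linear h" "\<forall>x\<in>B. h x = (if x = b then 1 else 0)"
    using linear_independent_extend[OF B(2), of "\<lambda>x. if x = b then 1 else 0"] by blast
  have h_S: "h y = 0" if "y \<in> S" for y
    using linear_eq_0_on_span[OF h(1), of "B - {b}" y] h(2) that by (auto simp: S_def)
  have h_le: "\<bar>h x\<bar> \<le> norm x / d" if x: "x \<in> E m" for x
  proof -
    have "insert b (B - {b}) = B" using b by blast
    then obtain \<alpha> where \<alpha>: "x - \<alpha> *\<^sub>R b \<in> S"
      using x B(3) span_breakdown_eq[of x b "B - {b}"] by (auto simp: S_def)
    have "h x = h (\<alpha> *\<^sub>R b) + h (x - \<alpha> *\<^sub>R b)"
      using linear_add[OF h(1), of "\<alpha> *\<^sub>R b" "x - \<alpha> *\<^sub>R b"] by simp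
    also have "\<dots> = \<alpha>"
      using h(2) b h_S[OF \<alpha>] by (simp add: linear_scale[OF h(1)])
    finally show ?thesis
      using d(2)[OF \<alpha>, of \<alpha>] d(1) by (simp add: field_simps)
  qed
  obtain C where C: "C \<ge> 0" "\<And>x. norm (FDD_component E x m) \<le> C * norm x"
    using component_bound by blast
  have "bounded_linear (\<lambda>x. h (FDD_component E x m))"
  proof (rule bounded_linear_intro)
    show "norm (h (FDD_component E x m)) \<le> norm x * (C / d)" for x
    proof -
      have "\<bar>h (FDD_component E x m)\<bar> \<le> norm (FDD_component E x m) / d"
        by (intro h_le component)
      also have "\<dots> \<le> (C * norm x) / d"
        using d(1) by (intro divide_right_mono C(2)) simp
      finally show ?thesis by (simp add: mult.commute)
    qed
  qed (simp_all add: component_add component_scale linear_add[OF h(1)] linear_scale[OF h(1)])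
  then obtain g :: "'a \<Rightarrow>\<^sub>L real" where g: "\<And>x. blinfun_apply g x = h (FDD_component E x m)"
    using bounded_linear_Blinfun_apply by metis
  have "b \<in> E m" using b B(3) span_base by blast
  then have "blinfun_apply g b = 1"
    using h(2) b by (simp add: g component_of_mem)
  then have "g \<noteq> 0" by auto
  moreover have "g \<in> FDD_dual E m"
    using linear_0[OF h(1)] by (auto simp: FDD_dual_def g component_of_mem)
  then have "g /\<^sub>R norm g \<in> FDD_dual E m"
    by (auto simp: FDD_dual_def blinfun.scaleR_left)
  ultimately show ?thesis by (intro bexI[of _ "g /\<^sub>R norm g"]) auto
qed

text \<open>Continuity lets \<open>f\<close> act termwise on the expansion of \<open>x\<close>, and
  only the \<open>m\<close>-th term survives.\<close>

lemma FDD_dual_apply: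
  assumes "f \<in> FDD_dual E m"
  shows "blinfun_apply f x = blinfun_apply f (FDD_component E x m)"
proof -
  have "(\<lambda>i. blinfun_apply f (FDD_component E x i)) sums blinfun_apply f x"
    by (rule bounded_linear.sums[OF blinfun.bounded_linear_right component(2)])
  moreover have "(\<lambda>i. blinfun_apply f (FDD_component E x i))
      = (\<lambda>i. if i = m then blinfun_apply f (FDD_component E x i) else 0)"
    using assms component(1) by (auto simp: FDD_dual_def)
  ultimately show ?thesis
    using sums_single[of m "\<lambda>i. blinfun_apply f (FDD_component E x i)"] sums_unique2 by metis
qed

lemma dual_proj_add_scaled:
  "FDD_dual_proj E n (f + t *\<^sub>R g) = FDD_dual_proj E n f + t *\<^sub>R FDD_dual_proj E n g"
  unfolding FDD_dual_proj_def
  by (simp only: bounded_bilinear.add_left[OF bounded_bilinear_blinfun_compose]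
      bounded_bilinear.scaleR_left[OF bounded_bilinear_blinfun_compose])

text \<open>Indices start at 0, so the \<open>n\<close>-th partial sum keeps exactly the components
  below \<open>n\<close>; hence the strict \<open>m < n\<close>.\<close>

lemma dual_proj_dual:
  assumes "f \<in> FDD_dual E m"
  shows "FDD_dual_proj E n f = (if m < n then f else 0)"
proof (rule blinfun_eqI)
  fix x
  have "blinfun_apply (FDD_dual_proj E n f) x
      = (\<Sum>i<n. blinfun_apply f (FDD_component E x i))"
    by (simp add: FDD_dual_proj_def FDD_proj_apply psum_def blinfun.sum_right)
  also have "\<dots> = (\<Sum>i<n. if i = m then blinfun_apply f (FDD_component E x m) else 0)"
    using assms component(1) by (intro sum.cong) (auto simp: FDD_dual_def)
  also have "\<dots> = blinfun_apply (if m < n then f else 0) x"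
    by (simp flip: FDD_dual_apply[OF assms])
  finally show "blinfun_apply (FDD_dual_proj E n f) x = \<dots>" .
qed

text \<open>An element of the span involves finitely many dual components, and beyond their indices
  the adjoint projection fixes all of them.\<close>

lemma dual_proj_eventually_id:
  assumes "f \<in> span (\<Union>n. FDD_dual E n)"
  shows "\<exists>N. \<forall>n\<ge>N. FDD_dual_proj E n f = f"
  using assms
proof (induction rule: span_induct_alt)
  case base
  show ?case by (simp add: FDD_dual_proj_def)
next
  case (step c x y)
  obtain m where m: "x \<in> FDD_dual E m" using step.hyps by blast
  obtain N where N: "\<forall>n\<ge>N. FDD_dual_proj E n y = y" using step.IH by blast
  show ?case
  proof (intro exI allI impI)
    fix n assume "n \<ge> max N (Suc m)"
    with N dual_proj_dual[OF m, of n] show "FDD_dual_proj E n (c *\<^sub>R x + y) = c *\<^sub>R x + y"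
      using dual_proj_add_scaled[of n y c x] by (simp add: add.commute)
  qed
qed

end

subsection \<open>Weak* null sequences in the tails\<close>

text \<open>Lets a functional be replaced by a norm-close one without leaving a weak*
  neighbourhood.\<close>

lemma weak_star_open_imp_open:
  fixes V :: "('a::real_normed_vector \<Rightarrow>\<^sub>L real) set"
  assumes "openin weak_star V"
  shows "open V"
proof -
  have "openin euclidean {f \<in> topspace euclidean. f \<in> V}"
    by (rule openin_continuous_map_preimage[OF strong_operator_topology_weaker_than_euclidean assms])
  then show ?thesis by simp
qed

text \<open>The weak* topology is the pullback along \<open>blinfun_apply\<close> of the product
  topology, where convergence is coordinatewise.\<close>

lemma limitin_weak_star_iff:
  "limitin weak_star F f sequentially \<longleftrightarrow>
    (\<forall>x. (\<lambda>n. blinfun_apply (F n) x) \<longlonglongrightarrow> blinfun_apply f x)"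
proof
  assume lim: "limitin weak_star F f sequentially"
  show "\<forall>x. (\<lambda>n. blinfun_apply (F n) x) \<longlonglongrightarrow> blinfun_apply f x"
  proof
    fix x
    have "limitin euclidean ((\<lambda>f. blinfun_apply f x) \<circ> F) (blinfun_apply f x) sequentially"
      using continuous_map_limit[OF strong_operator_topology_continuous_evaluation lim] .
    then show "(\<lambda>n. blinfun_apply (F n) x) \<longlonglongrightarrow> blinfun_apply f x"
      by (simp add: o_def)
  qed
next
  assume "\<forall>x. (\<lambda>n. blinfun_apply (F n) x) \<longlonglongrightarrow> blinfun_apply f x"
  then have "limitin (product_topology (\<lambda>_. euclidean) UNIV)
      (\<lambda>n. blinfun_apply (F n)) (blinfun_apply f) sequentially"
    by (simp add: limitin_componentwise)
  then have lim: "(\<lambda>n. blinfun_apply (F n)) \<longlonglongrightarrow> blinfun_apply f"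
    by (simp add: euclidean_product_topology)
  show "limitin weak_star F f sequentially"
    unfolding limitin_def strong_operator_topology_topspace
  proof (intro conjI allI impI)
    fix V assume V: "openin weak_star V \<and> f \<in> V"
    then obtain U where "open U" "V = blinfun_apply -` U"
      by (auto simp: strong_operator_topology_def openin_pullback_topology)
    with V lim show "\<forall>\<^sub>F n in sequentially. F n \<in> V"
      by (auto dest: topological_tendstoD)
  qed simp
qed

text \<open>What cases (i) and (ii) have in common. The single equation yields
  \<open>P n f' = f'\<close> at \<open>t = 0\<close> and makes \<open>g m\<close> invisible to
  \<open>P n\<close>, without asking \<open>P\<close> to be linear; \<open>m \<ge> n\<close> fits
  because \<open>P n\<close> involves indices below \<open>n\<close> only.\<close>

definition tail_sequence ::
  "(nat \<Rightarrow> ('a::banach \<Rightarrow>\<^sub>L real) \<Rightarrow> ('a \<Rightarrow>\<^sub>L real)) \<Rightarrow> (nat \<Rightarrow> 'a \<Rightarrow>\<^sub>L real) \<Rightarrow> bool" where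
  "tail_sequence P g \<longleftrightarrow>
     (\<forall>m. norm (g m) = 1) \<and> (\<forall>x. (\<lambda>m. blinfun_apply (g m) x) \<longlonglongrightarrow> 0) \<and>
     (\<forall>f. \<forall>\<delta>>0. \<exists>f' N. norm (f - f') < \<delta> \<and>
       (\<forall>n\<ge>N. \<forall>m\<ge>n. \<forall>t. P n (f' + t *\<^sub>R g m) = f'))"

text \<open>\<open>g m\<close> is a unit vector of the \<open>m\<close>-th dual component. It sees
  only the \<open>m\<close>-th component of \<open>x\<close>, whose norm tends to 0, so
  \<open>g\<close> is weak* null; the shrinking property supplies the dense set of
  \<open>f'\<close>.\<close>

lemma shrinking_FDD_tail_sequence:
  fixes E :: "nat \<Rightarrow> 'a::banach set"
  assumes "shrinking_FDD E"
  shows "\<exists>g. tail_sequence (FDD_dual_proj E) g"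
proof -
  interpret fdd E
    by (rule fdd.intro) (use assms in \<open>simp add: shrinking_FDD_def\<close>)
  have "\<forall>m. \<exists>g. g \<in> FDD_dual E m \<and> norm g = 1"
    using FDD_dual_norm_one by blast
  then obtain g where g: "\<And>m. g m \<in> FDD_dual E m" "\<And>m. norm (g m) = 1"
    by (auto dest!: choice)
  have "(\<lambda>m. blinfun_apply (g m) x) \<longlonglongrightarrow> 0" for x
  proof (rule Lim_null_comparison)
    show "(\<lambda>m. norm (FDD_component E x m)) \<longlonglongrightarrow> 0"
      using summable_LIMSEQ_zero[OF sums_summable[OF component(2)]] by (rule tendsto_norm_zero)
    have "norm (blinfun_apply (g m) x) \<le> norm (FDD_component E x m)" for m
      using norm_blinfun[of "g m" "FDD_component E x m"]
      by (simp add: FDD_dual_apply[OF g(1), of m x] g(2))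
    then show "\<forall>\<^sub>F m in sequentially.
        norm (blinfun_apply (g m) x) \<le> norm (FDD_component E x m)" by simp
  qed
  moreover have "\<exists>f' N. norm (f - f') < \<delta> \<and>
      (\<forall>n\<ge>N. \<forall>m\<ge>n. \<forall>t. FDD_dual_proj E n (f' + t *\<^sub>R g m) = f')" if "\<delta> > 0" for f \<delta>
  proof -
    have "f \<in> closure (span (\<Union>n. FDD_dual E n))"
      using assms by (simp add: shrinking_FDD_def)
    then obtain f' where f': "f' \<in> span (\<Union>n. FDD_dual E n)" "norm (f - f') < \<delta>"
      using \<open>\<delta> > 0\<close> by (auto simp: closure_approachable dist_norm norm_minus_commute)
    obtain N where "\<forall>n\<ge>N. FDD_dual_proj E n f' = f'"
      using dual_proj_eventually_id[OF f'(1)] by blast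
    then have "\<forall>n\<ge>N. \<forall>m\<ge>n. \<forall>t. FDD_dual_proj E n (f' + t *\<^sub>R g m) = f'"
      by (simp add: dual_proj_add_scaled dual_proj_dual[OF g(1)])
    with f'(2) show ?thesis by blast
  qed
  ultimately show ?thesis unfolding tail_sequence_def using g(2) by blast
qed

lemma basis_coeff_eqI:
  assumes "schauder_basis e" "(\<lambda>i. a i *\<^sub>R e i) sums x"
  shows "basis_coeff e x = a"
  unfolding basis_coeff_def
  by (rule the1_equality) (use assms in \<open>simp_all add: schauder_basis_def\<close>)

lemma basis_coeff_sums:
  assumes "schauder_basis e"
  shows "(\<lambda>i. basis_coeff e x i *\<^sub>R e i) sums x"
  unfolding basis_coeff_def
  using theI'[of "\<lambda>a. (\<lambda>i. a i *\<^sub>R e i) sums x"] assms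
  by (simp add: schauder_basis_def)

text \<open>The normalised basis serves as \<open>g\<close>: the positive infimum of the norms
  preserves weak* nullity. Partial sums of the expansion of \<open>f\<close> serve as
  \<open>f'\<close>.\<close>

lemma schauder_basis_tail_sequence:
  fixes e :: "nat \<Rightarrow> 'a::banach \<Rightarrow>\<^sub>L real"
  assumes e: "schauder_basis e" "semi_normalized e" "weak_star_null e"
  shows "\<exists>g. tail_sequence (basis_proj e) g"
proof -
  define c where "c = (INF n. norm (e n))"
  have c: "c > 0" "c \<le> norm (e m)" for m
    using e(2) by (auto simp: semi_normalized_def c_def intro!: cINF_lower bdd_belowI[of _ 0])
  define g where "g m = e m /\<^sub>R norm (e m)" for m
  have "norm (g m) = 1" for m
    using c(1) c(2)[of m] by (cases "e m = 0") (simp_all add: g_def)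
  moreover have "(\<lambda>m. blinfun_apply (g m) x) \<longlonglongrightarrow> 0" for x
  proof (rule Lim_null_comparison)
    have "(\<lambda>m. blinfun_apply (e m) x) \<longlonglongrightarrow> 0"
      using e(3) by (simp add: weak_star_null_def limitin_weak_star_iff)
    then show "(\<lambda>m. norm (blinfun_apply (e m) x) / c) \<longlonglongrightarrow> 0"
      by (intro tendsto_divide_zero tendsto_norm_zero)
    have "norm (blinfun_apply (g m) x) \<le> norm (blinfun_apply (e m) x) / c" for m
    proof -
      have "norm (blinfun_apply (g m) x) = norm (blinfun_apply (e m) x) / norm (e m)"
        by (simp add: g_def blinfun.scaleR_left divide_inverse mult.commute abs_mult)
      also have "\<dots> \<le> norm (blinfun_apply (e m) x) / c"
        using c(1) c(2)[of m] order_less_le_trans[OF c] by (intro divide_left_mono mult_pos_pos) auto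
      finally show ?thesis .
    qed
    then show "\<forall>\<^sub>F m in sequentially.
        norm (blinfun_apply (g m) x) \<le> norm (blinfun_apply (e m) x) / c" by simp
  qed
  moreover have "\<exists>f' N. norm (f - f') < \<delta> \<and>
      (\<forall>n\<ge>N. \<forall>m\<ge>n. \<forall>t. basis_proj e n (f' + t *\<^sub>R g m) = f')" if "\<delta> > 0" for f \<delta>
  proof -
    define a where "a = basis_coeff e f"
    have "(\<lambda>n. \<Sum>i<n. a i *\<^sub>R e i) \<longlonglongrightarrow> f"
      using basis_coeff_sums[OF e(1), of f] by (simp add: sums_def a_def)
    from LIMSEQ_D[OF this \<open>\<delta> > 0\<close>]
    obtain N where N: "norm (f - (\<Sum>i<N. a i *\<^sub>R e i)) < \<delta>"
      by (auto simp: norm_minus_commute)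
    define f' where "f' = (\<Sum>i<N. a i *\<^sub>R e i)"
    have "basis_proj e n (f' + t *\<^sub>R g m) = f'" if "n \<ge> N" "m \<ge> n" for n m t
    proof -
      \<comment> \<open>The coefficients of \<open>f' + t *\<^sub>R g m\<close>, identified by
        uniqueness of the expansion. Beyond \<open>N\<close> only the index \<open>m\<close> can
        contribute, and \<open>basis_proj e n\<close> does not reach it as
        \<open>m \<ge> n\<close>.\<close>
      define b where "b i = (if i < N then a i else 0) + (if i = m then t / norm (e m) else 0)" for i
      have eq: "(\<Sum>i<k. b i *\<^sub>R e i) = f' + (if m < k then t *\<^sub>R g m else 0)" if "k \<ge> N" for k
      proof -
        have "(\<Sum>i<k. b i *\<^sub>R e i) = (\<Sum>i<k. if i < N then a i *\<^sub>R e i else 0)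
            + (\<Sum>i<k. if i = m then (t / norm (e m)) *\<^sub>R e m else 0)"
          unfolding sum.distrib[symmetric] by (rule sum.cong) (auto simp: b_def scaleR_add_left)
        also have "(\<Sum>i<k. if i < N then a i *\<^sub>R e i else 0) = f'"
          unfolding f'_def using that by (intro sum.mono_neutral_cong_right) auto
        finally show ?thesis by (simp add: g_def divide_inverse)
      qed
      have "(\<lambda>i. b i *\<^sub>R e i) sums (\<Sum>i<Suc m. b i *\<^sub>R e i)"
        by (rule sums_finite) (use that in \<open>auto simp: b_def\<close>)
      then have "(\<lambda>i. b i *\<^sub>R e i) sums (f' + t *\<^sub>R g m)"
        using eq[of "Suc m"] that by simp
      then show ?thesis
        using eq[of n] that by (simp add: basis_proj_def basis_coeff_eqI[OF e(1)])
    qed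
    with N show ?thesis unfolding f'_def by blast
  qed
  ultimately show ?thesis unfolding tail_sequence_def by blast
qed

subsection \<open>The Szlenk derivation of the dual ball\<close>

text \<open>The geometric part: two points of the ball at distance \<open>2 * t\<close> converge
  weak* to the same \<open>f'\<close>. Taking \<open>f'\<close> near \<open>f\<close> suffices
  because weak* open sets are norm open.\<close>

lemma szlenk_deriv_mem:
  fixes f :: "'a::banach \<Rightarrow>\<^sub>L real"
  assumes "\<epsilon> < 2 * t"
    and g: "\<And>m. norm (g m) = 1" "\<And>x. (\<lambda>m. blinfun_apply (g m) x) \<longlonglongrightarrow> 0"
    and near: "\<And>\<delta>. \<delta> > 0 \<Longrightarrow> \<exists>f'. norm (f - f') < \<delta> \<and>
      (\<forall>\<^sub>F m in sequentially. norm (f' + t *\<^sub>R g m) \<le> 1 \<and> norm (f' - t *\<^sub>R g m) \<le> 1)"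
  shows "f \<in> szlenk_deriv \<epsilon> (cball 0 1)"
proof -
  have "norm f \<le> 1"
  proof (rule field_le_epsilon)
    fix \<delta> :: real assume "\<delta> > 0"
    then obtain f' where f': "norm (f - f') < \<delta>" "\<forall>\<^sub>F m in sequentially.
        norm (f' + t *\<^sub>R g m) \<le> 1 \<and> norm (f' - t *\<^sub>R g m) \<le> 1"
      using near by blast
    obtain m where "norm (f' + t *\<^sub>R g m) \<le> 1" "norm (f' - t *\<^sub>R g m) \<le> 1"
      using eventually_happens[OF f'(2)] by auto
    \<comment> \<open>\<open>f'\<close> is the midpoint of two points of the ball, so it lies in the
      ball, and \<open>f\<close> is within \<open>\<delta>\<close> of it.\<close>
    moreover have "2 *\<^sub>R f' = (f' + t *\<^sub>R g m) + (f' - t *\<^sub>R g m)"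
      by (simp add: scaleR_2)
    then have "2 * norm f' \<le> norm (f' + t *\<^sub>R g m) + norm (f' - t *\<^sub>R g m)"
      using norm_triangle_ineq by (metis norm_scaleR abs_numeral)
    ultimately have "norm f' \<le> 1" by linarith
    with f'(1) show "norm f \<le> 1 + \<delta>"
      using norm_triangle_sub[of f f'] by linarith
  qed
  moreover have "diameter (cball 0 1 \<inter> V) > \<epsilon>" if V: "openin weak_star V" "f \<in> V" for V
  proof -
    obtain \<delta> where \<delta>: "\<delta> > 0" "ball f \<delta> \<subseteq> V"
      using weak_star_open_imp_open[OF V(1)] V(2) by (meson openE)
    obtain f' where f': "norm (f - f') < \<delta>" "\<forall>\<^sub>F m in sequentially.
        norm (f' + t *\<^sub>R g m) \<le> 1 \<and> norm (f' - t *\<^sub>R g m) \<le> 1"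
      using near[OF \<delta>(1)] by blast
    have "f' \<in> V" using f'(1) \<delta>(2) by (auto simp: dist_norm)
    \<comment> \<open>Stated for every \<open>s\<close> so that it serves for both \<open>t\<close>
      and \<open>-t\<close>.\<close>
    have "limitin weak_star (\<lambda>m. f' + s *\<^sub>R g m) f' sequentially" for s
      unfolding limitin_weak_star_iff
    proof
      fix x
      show "(\<lambda>m. blinfun_apply (f' + s *\<^sub>R g m) x) \<longlonglongrightarrow> blinfun_apply f' x"
        using tendsto_add[OF tendsto_const tendsto_mult_left[OF g(2)[of x], of s]]
        by (simp add: blinfun.add_left blinfun.scaleR_left)
    qed
    then have ev: "\<forall>\<^sub>F m in sequentially. f' + s *\<^sub>R g m \<in> V" for s
      using V(1) \<open>f' \<in> V\<close> by (auto simp: limitin_def)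
    have "\<forall>\<^sub>F m in sequentially. f' + t *\<^sub>R g m \<in> cball 0 1 \<inter> V \<and> f' - t *\<^sub>R g m \<in> cball 0 1 \<inter> V"
      using f'(2) ev[of t] ev[of "-t"] by eventually_elim auto
    then obtain m where m: "f' + t *\<^sub>R g m \<in> cball 0 1 \<inter> V" "f' - t *\<^sub>R g m \<in> cball 0 1 \<inter> V"
      using eventually_happens by fastforce
    have "dist (f' + t *\<^sub>R g m) (f' - t *\<^sub>R g m) \<le> diameter (cball 0 1 \<inter> V)"
      by (rule diameter_bounded_bound[OF _ m]) (simp add: bounded_Int)
    moreover have "dist (f' + t *\<^sub>R g m) (f' - t *\<^sub>R g m) = norm ((2 * t) *\<^sub>R g m)"
      unfolding dist_norm by (rule arg_cong[where f = norm]) (simp add: algebra_simps flip: scaleR_2)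
    ultimately show ?thesis using assms(1) by (simp add: g(1))
  qed
  ultimately show ?thesis by (simp add: szlenk_deriv_def)
qed

text \<open>\<open>szlenk_radius\<close> is a real supremum, so its set must be bounded above: the
  derived set lies in the unit ball, and testing at the unit vector \<open>g\<close> gives
  \<open>r \<le> 1\<close>.\<close>

lemma szlenk_radius_geI:
  fixes g :: "'a::banach \<Rightarrow>\<^sub>L real"
  assumes "norm g = 1" "0 < R"
    and "\<And>r f. \<lbrakk>0 < r; r < R; norm (f :: 'a \<Rightarrow>\<^sub>L real) \<le> r\<rbrakk> \<Longrightarrow> f \<in> szlenk_deriv \<epsilon> (cball 0 1)"
  shows "R \<le> szlenk_radius TYPE('a) \<epsilon>"
proof -
  define A where "A = {r. r > 0 \<and> (\<lambda>f. r *\<^sub>R f) ` cball (0 :: 'a \<Rightarrow>\<^sub>L real) 1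
    \<subseteq> szlenk_deriv \<epsilon> (cball 0 1)}"
  have "r \<le> 1" if "r \<in> A" for r
  proof -
    have "r *\<^sub>R g \<in> szlenk_deriv \<epsilon> (cball 0 1)" "r > 0"
      using that assms(1) by (auto simp: A_def image_subset_iff)
    then show ?thesis using assms(1) by (simp add: szlenk_deriv_def)
  qed
  then have bdd: "bdd_above A" by (rule bdd_aboveI)
  have "r \<le> Sup A" if "r < R" for r
  proof -
    \<comment> \<open>\<open>dense_le\<close> asks for every \<open>r < R\<close>, including
      nonpositive ones, while the set holds only positive radii; \<open>R / 2\<close> lifts
      \<open>r\<close> into that range.\<close>
    define r' where "r' = max r (R / 2)"
    have r': "0 < r'" "r' < R" "r \<le> r'" using that assms(2) by (auto simp: r'_def)
    have "r' *\<^sub>R f \<in> szlenk_deriv \<epsilon> (cball 0 1)" if "norm f \<le> 1" for f :: "'a \<Rightarrow>\<^sub>L real"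
      using r' that by (intro assms(3)[of r']) (auto simp: mult_left_le)
    then have "r' \<in> A" using r'(1) by (auto simp: A_def)
    then show ?thesis using cSup_upper[OF _ bdd] r'(3) by force
  qed
  then have "R \<le> Sup A" by (rule dense_le)
  then show ?thesis by (simp add: szlenk_radius_def A_def)
qed

section \<open>The lower estimate of the Szlenk radius\<close>

theorem theorem3:
  fixes P :: "nat \<Rightarrow> ('a::banach \<Rightarrow>\<^sub>L real) \<Rightarrow> ('a \<Rightarrow>\<^sub>L real)"
    and j :: "('a \<Rightarrow>\<^sub>L real) \<Rightarrow> 'z::banach"
    and C1 C2 \<epsilon> :: real
    and \<phi> \<psi> chi :: "real \<Rightarrow> real"
  assumes cases:
      "(\<exists>E :: nat \<Rightarrow> 'a set. shrinking_FDD E \<and> P = FDD_dual_proj E) \<or>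
       (\<exists>e :: nat \<Rightarrow> 'a \<Rightarrow>\<^sub>L real.
          schauder_basis e \<and> semi_normalized e \<and> weak_star_null e \<and> P = basis_proj e)"
    and Z: "inj j"
    and C: "0 < C1" "0 < C2"
    and equiv: "\<And>f. C1 * norm (j f) \<le> norm f \<and> norm f \<le> C2 * norm (j f)"
    and bij: "cont_bij_nonneg \<phi>" "cont_bij_nonneg \<psi>" "cont_bij_nonneg chi"
    and ineq: "\<exists>N. \<forall>n\<ge>N. \<forall>f.
        chi (norm (j f)) \<le> \<phi> (norm (j (P n f))) + \<psi> (norm (j (f - P n f)))"
    and eps: "0 < \<epsilon>" "\<epsilon> < 2 * C1 * inv_nonneg \<psi> (chi (1 / C2))"
  shows "szlenk_radius TYPE('a) \<epsilon>
           \<ge> C1 * inv_nonneg \<phi> (chi (1 / C2) - \<psi> (\<epsilon> / (2 * C1)))"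
proof -
  obtain g where g: "\<And>m. norm (g m) = 1" "\<And>x. (\<lambda>m. blinfun_apply (g m) x) \<longlonglongrightarrow> 0"
    and dense: "\<And>f \<delta>. \<delta> > 0 \<Longrightarrow> \<exists>f' N. norm (f - f') < \<delta> \<and>
      (\<forall>n\<ge>N. \<forall>m\<ge>n. \<forall>t. P n (f' + t *\<^sub>R g m) = f')"
  proof -
    have "\<exists>g. tail_sequence P g"
      using cases by (auto intro: shrinking_FDD_tail_sequence schauder_basis_tail_sequence)
    with that show thesis unfolding tail_sequence_def by blast
  qed
  \<comment> \<open>\<open>N0\<close> does not depend on the functional, so a single
    \<open>n\<close> will serve all the points \<open>f' + s *\<^sub>R g m\<close> at once.\<close>
  obtain N0 where N0: "\<And>n f. n \<ge> N0 \<Longrightarrow>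
      chi (norm (j f)) \<le> \<phi> (norm (j (P n f))) + \<psi> (norm (j (f - P n f)))"
    using ineq by blast
  define X where "X = chi (1 / C2)"
  define Y where "Y = \<psi> (\<epsilon> / (2 * C1))"
  define R where "R = C1 * inv_nonneg \<phi> (X - Y)"
  have X0: "X \<ge> 0"
    unfolding X_def using C by (intro cont_bij_nonneg_nonneg[OF bij(3)]) simp
  \<comment> \<open>The upper bound on \<open>\<epsilon>\<close> amounts to \<open>Y < X\<close>, so
    the argument \<open>X - Y\<close> of the inverse is positive, and with it
    \<open>R\<close>.\<close>
  have "\<epsilon> / (2 * C1) < inv_nonneg \<psi> X"
    using eps(2) C by (simp add: X_def field_simps)
  then have "Y < \<psi> (inv_nonneg \<psi> X)"
    unfolding Y_def
    using cont_bij_nonneg_inv[OF bij(2) X0] eps(1) C by (subst cont_bij_nonneg_less_iff[OF bij(2)]) auto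
  then have XY: "X - Y > 0"
    using cont_bij_nonneg_inv[OF bij(2) X0] by simp
  note R_inv = cont_bij_nonneg_inv[OF bij(1) less_imp_le[OF XY]]
  have "inv_nonneg \<phi> (X - Y) \<noteq> 0"
    using R_inv(2) XY cont_bij_nonneg_zero[OF bij(1)] by auto
  with R_inv(1) C(1) have R0: "R > 0" by (simp add: R_def)
  have "R \<le> szlenk_radius TYPE('a) \<epsilon>"
  proof (rule szlenk_radius_geI[OF g(1) R0])
    fix r and f :: "'a \<Rightarrow>\<^sub>L real" assume r: "0 < r" "r < R" "norm f \<le> r"
    have "\<phi> (r / C1) < X - Y"
    proof -
      have "r / C1 < inv_nonneg \<phi> (X - Y)"
        using r(2) C(1) by (simp add: R_def field_simps)
      then show ?thesis
        using cont_bij_nonneg_less_iff[OF bij(1), of "r / C1" "inv_nonneg \<phi> (X - Y)"] R_inv r(1) C(1)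
        by simp
    qed
    then have "\<phi> (r / C1) + \<psi> (\<epsilon> / (2 * C1)) < X" by (simp add: Y_def)
    \<comment> \<open>The strict inequality leaves room: by continuity both arguments may grow by a
      common \<open>x > 0\<close>. One increment pays for replacing \<open>f\<close> by
      \<open>f'\<close>, the other for taking \<open>t\<close> above
      \<open>\<epsilon> / 2\<close>.\<close>
    moreover have "((\<lambda>x. \<phi> (r / C1 + x) + \<psi> (\<epsilon> / (2 * C1) + x))
        \<longlongrightarrow> \<phi> (r / C1) + \<psi> (\<epsilon> / (2 * C1))) (at_right 0)"
      using r(1) C(1) eps(1) by (intro tendsto_add cont_bij_nonneg_tendsto bij) auto
    ultimately have "\<forall>\<^sub>F x in at_right 0. \<phi> (r / C1 + x) + \<psi> (\<epsilon> / (2 * C1) + x) < X"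
      by (rule order_tendstoD(2)[rotated])
    then have "\<forall>\<^sub>F x in at_right 0. \<phi> (r / C1 + x) + \<psi> (\<epsilon> / (2 * C1) + x) < X \<and> x > 0"
      using eventually_at_right_less by (rule eventually_conj)
    then obtain x where x: "\<phi> (r / C1 + x) + \<psi> (\<epsilon> / (2 * C1) + x) < X" "x > 0"
      using eventually_happens[of _ "at_right (0::real)"] by auto
    \<comment> \<open>Chosen so that \<open>2 * t\<close> exceeds \<open>\<epsilon>\<close> while
      \<open>t / C1\<close> is the enlarged argument of \<open>\<psi>\<close>.\<close>
    define t where "t = \<epsilon> / 2 + C1 * x"
    have t: "t > 0" "t / C1 = \<epsilon> / (2 * C1) + x"
      using eps(1) C(1) x(2) by (simp_all add: t_def add_divide_distrib add_pos_pos)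
    show "f \<in> szlenk_deriv \<epsilon> (cball 0 1)"
    proof (rule szlenk_deriv_mem[OF _ g])
      show "\<epsilon> < 2 * t" using C(1) x(2) by (simp add: t_def)
      fix \<delta> :: real assume "\<delta> > 0"
      \<comment> \<open>Closeness \<open>\<delta>\<close> is what the lemma asks for; closeness
        \<open>C1 * x\<close> keeps \<open>norm (j f')\<close> within
        \<open>r / C1 + x\<close>.\<close>
      then have "min \<delta> (C1 * x) > 0" using C(1) x(2) by simp
      from dense[OF this, of f] obtain f' N where f': "norm (f - f') < min \<delta> (C1 * x)"
        "\<And>n m t. n \<ge> N \<Longrightarrow> m \<ge> n \<Longrightarrow> P n (f' + t *\<^sub>R g m) = f'"
        by blast
      define n where "n = max N N0"
      have j_le: "norm (j h) \<le> norm h / C1" for h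
        using equiv[of h] C(1) by (simp add: field_simps)
      have "norm f' \<le> r + C1 * x"
        using norm_triangle_sub[of f' f] f'(1) r(3) by (simp add: norm_minus_commute)
      then have "norm f' / C1 \<le> r / C1 + x"
        using C(1) by (simp add: field_simps)
      then have "norm (j f') \<le> r / C1 + x"
        using j_le[of f'] by linarith
      have le: "norm (f' + s *\<^sub>R g m) \<le> 1" if "m \<ge> n" "\<bar>s\<bar> = t" for m s
      proof -
        have "norm (s *\<^sub>R g m) / C1 = t / C1" using that(2) by (simp add: g(1))
        then have sg: "norm (j (s *\<^sub>R g m)) \<le> \<epsilon> / (2 * C1) + x"
          using j_le[of "s *\<^sub>R g m"] t(2) by linarith
        \<comment> \<open>Since \<open>P n\<close> maps \<open>f' + s *\<^sub>R g m\<close> to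
          \<open>f'\<close>, the two terms on the right involve only \<open>f'\<close> and
          \<open>s *\<^sub>R g m\<close>.\<close>
        have "chi (norm (j (f' + s *\<^sub>R g m))) \<le> \<phi> (norm (j f')) + \<psi> (norm (j (s *\<^sub>R g m)))"
          using N0[of n "f' + s *\<^sub>R g m"] f'(2)[of n m s] that(1) by (simp add: n_def)
        also have "\<dots> \<le> \<phi> (r / C1 + x) + \<psi> (\<epsilon> / (2 * C1) + x)"
          using cont_bij_nonneg_less_iff[OF bij(1), of "r / C1 + x" "norm (j f')"]
            cont_bij_nonneg_less_iff[OF bij(2), of "\<epsilon> / (2 * C1) + x" "norm (j (s *\<^sub>R g m))"]
            \<open>norm (j f') \<le> r / C1 + x\<close> sg r(1) C(1) x(2) eps(1)
          by (intro add_mono) (auto simp: not_less[symmetric])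
        also have "\<dots> < chi (1 / C2)" using x(1) by (simp add: X_def)
        \<comment> \<open>Strict monotonicity cancels \<open>chi\<close>, and the constant
          \<open>C2\<close> leads back to the dual norm.\<close>
        finally have "norm (j (f' + s *\<^sub>R g m)) < 1 / C2"
          using cont_bij_nonneg_less_iff[OF bij(3), of "norm (j (f' + s *\<^sub>R g m))" "1 / C2"] C(2)
          by simp
        then have "C2 * norm (j (f' + s *\<^sub>R g m)) \<le> 1"
          using C(2) by (simp add: field_simps)
        then show ?thesis using equiv[of "f' + s *\<^sub>R g m"] by linarith
      qed
      have "\<forall>\<^sub>F m in sequentially. norm (f' + t *\<^sub>R g m) \<le> 1 \<and> norm (f' - t *\<^sub>R g m) \<le> 1"
        using eventually_ge_at_top[of n]
        by eventually_elim (use le[of _ t] le[of _ "-t"] t(1) in auto)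
      with f'(1) show "\<exists>f'. norm (f - f') < \<delta> \<and> (\<forall>\<^sub>F m in sequentially.
          norm (f' + t *\<^sub>R g m) \<le> 1 \<and> norm (f' - t *\<^sub>R g m) \<le> 1)"
        by auto
    qed
  qed
  then show ?thesis by (simp add: R_def X_def Y_def)
qed

end
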